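(* Let $G$ be a simple connected triangle- and quadrangle-free graph with $n\geq 3$ vertices and $m$ edges. Let $\delta$ and $\Delta$ denote the minimum and maximum edge neighborhood degrees of $G$, respectively, where $\delta\neq\Delta$. Let $a>1$ be real and set $s_a=\frac{\Delta^a-\delta^a}{\Delta-\delta}$. Then \[KB^a(G)\leq n\delta^a+(2n(n-1)-4m-n\delta)s_a,\] with equality if $G$ is a star graph.
   Context: Graphs are finite. A graph is triangle- and quadrangle-free if it contains no cycle of length 3 and no cycle of length 4 as a subgraph. The star graph on $n$ vertices is $K_{1,n-1}$. For a simple graph $G$ with vertex set $V(G)$, $d(u)$ denotes the degree of a vertex $u$. The degree of an edge $e=uv$ is $d_G(e)=d(u)+d(v)-2$. The edge neighborhood degree $S_e(v)$ of a vertex $v$ is the sum of the degrees $d_G(e)$ of all edges $e$ incident to $v$. For real $a\neq 0,1$, the general Kulli-Basava index is $KB^a(G)=\sum_{v\in V(G)}S_e(v)^a$. *)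

theory Defs
  imports Complex_Main "Graph_Theory.Graph_Theory"
begin

text \<open>
  A finite simple graph is a symmetric digraph without loops and parallel arcs (locale
  \<^locale>\<open>graph\<close>). Each undirected edge \<open>uv\<close> is therefore a pair of opposite arcs; it is
  recovered here as the set \<open>{u, v}\<close>. The degree of a vertex is its \<^const>\<open>out_degree\<close>, since
  exactly one arc of every incident edge leaves the vertex.
\<close>

definition uedges :: "('a, 'b) pre_digraph \<Rightarrow> 'a set set" where
  "uedges G = (\<lambda>e. {tail G e, head G e}) ` arcs G"

text \<open>
  A \<^const>\<open>pre_digraph.cycle\<close> \<open>p\<close> is a nonempty closed walk, given as its list of arcs, that repeats no vertex
  other than its endpoint. The only digraph cycles that are not cycles of the undirected graph
  are those of the form \<open>u, v, u\<close>, of length 2.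
\<close>

definition triangle_quadrangle_free :: "('a, 'b) pre_digraph \<Rightarrow> bool" where
  "triangle_quadrangle_free G \<longleftrightarrow>
     \<not> (\<exists>p. pre_digraph.cycle G p \<and> (length p = 3 \<or> length p = 4))"

text \<open>For an edge \<open>e = {u, v}\<close> this is \<open>d(u) + d(v) - 2\<close>.\<close>

definition edge_degree :: "('a, 'b) pre_digraph \<Rightarrow> 'a set \<Rightarrow> real" where
  "edge_degree G e = (\<Sum>u\<in>e. real (out_degree G u)) - 2"

definition edge_nbhd_degree :: "('a, 'b) pre_digraph \<Rightarrow> 'a \<Rightarrow> real" where
  "edge_nbhd_degree G v = (\<Sum>e\<in>{e \<in> uedges G. v \<in> e}. edge_degree G e)"

definition kulli_basava :: "real \<Rightarrow> ('a, 'b) pre_digraph \<Rightarrow> real" where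
  "kulli_basava a G = (\<Sum>v\<in>verts G. edge_nbhd_degree G v powr a)"

end

theory Submission
  imports Defs "HOL-Analysis.Convex"
begin

text \<open>
  For \<open>a > 1\<close> the function \<open>x powr a\<close> is convex on the nonnegative reals, so on \<open>[\<delta>, \<Delta>]\<close> it
  lies below its chord, whose slope is \<open>s\<close>. Adding up the chord inequality at all values
  \<open>S\<^sub>e(v)\<close> bounds the index by \<open>n \<delta>\<^sup>a + (\<Sigma> - n \<delta>) s\<close>, where \<open>\<Sigma>\<close> is the sum of all \<open>S\<^sub>e(v)\<close>
  (\<open>sum_powr_le_chord\<close>). As \<open>s \<ge> 0\<close>, only an upper bound on \<open>\<Sigma>\<close> is missing.

  Double counting of edges and of walks of length two gives
  \<open>\<Sigma> = 2 Q - 4 m\<close>, where \<open>Q\<close> adds up, over all vertices \<open>v\<close>, the degrees of the neighbours of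
  \<open>v\<close> (\<open>sum_edge_nbhd_degree\<close>). In the absence of triangles and quadrangles the neighbours of
  \<open>v\<close> send their other edges to pairwise distinct vertices outside the closed neighbourhood of
  \<open>v\<close>. So the degrees of the neighbours of \<open>v\<close> count distinct vertices different from \<open>v\<close>, and
  their sum is at most \<open>n - 1\<close> (\<open>sum_degree_nbrs_le\<close>); hence \<open>Q \<le> n (n - 1)\<close>.

  On a star both estimates are sharp: the neighbour degrees of every vertex add up to \<open>n - 1\<close>,
  and \<open>S\<^sub>e\<close> takes only two values, one at the centre and one at the leaves, which are
  \<open>\<delta>\<close> and \<open>\<Delta>\<close>, the points where the chord meets the graph of \<open>x powr a\<close>.
\<close>

section \<open>Chords of a power function\<close>

text \<open>
  Extends \<open>powr_convex\<close> to the closed half-line. If one of the two points is \<open>0\<close>, convexity says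
  that \<open>(t z)\<^sup>p \<le> t z\<^sup>p\<close>, which holds because \<open>t\<^sup>p \<le> t\<close> for \<open>0 < t < 1\<close>.
\<close>

lemma powr_convex_nonneg:
  fixes p :: real
  assumes "p \<ge> 1"
  shows "convex_on {0..} (\<lambda>x. x powr p)"
proof -
  have contract: "(t * z) powr p \<le> t * z powr p" if "0 < t" "t < 1" "0 \<le> z" for t z :: real
  proof -
    have "t powr p \<le> t powr 1"
      using that assms by (intro powr_mono') auto
    then show ?thesis
      using that by (simp add: powr_mult mult_right_mono)
  qed
  show ?thesis
  proof (rule convex_onI)
    fix t x y :: real
    assume t: "0 < t" "t < 1" and xy: "x \<in> {0..}" "y \<in> {0..}"
    show "((1 - t) *\<^sub>R x + t *\<^sub>R y) powr p \<le> (1 - t) * x powr p + t * y powr p"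
    proof (cases "x = 0 \<or> y = 0")
      case True
      then show ?thesis
        using contract[of t y] contract[of "1 - t" x] t xy by auto
    next
      case False
      then show ?thesis
        using convex_onD[OF powr_convex[OF assms], of t x y] t xy by auto
    qed
  qed (rule convex_real_interval)
qed

lemma sum_powr_le_chord:
  fixes f :: "'a \<Rightarrow> real" and p l u :: real
  assumes "p \<ge> 1" "0 \<le> l" and bounds: "\<And>v. v \<in> A \<Longrightarrow> f v \<in> {l..u}"
  defines "s \<equiv> (u powr p - l powr p) / (u - l)"
  shows "(\<Sum>v\<in>A. f v powr p) \<le> real (card A) * l powr p + ((\<Sum>v\<in>A. f v) - real (card A) * l) * s"
proof -
  have convex: "convex_on {l..u} (\<lambda>x. x powr p)"
    using \<open>0 \<le> l\<close> by (intro convex_on_subset[OF powr_convex_nonneg[OF \<open>p \<ge> 1\<close>]]) auto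
  have "(\<Sum>v\<in>A. f v powr p) \<le> (\<Sum>v\<in>A. s * (f v - l) + l powr p)"
    unfolding s_def by (intro sum_mono convex_onD_Icc'[OF convex] bounds)
  also have "\<dots> = real (card A) * l powr p + ((\<Sum>v\<in>A. f v) - real (card A) * l) * s"
    by (simp add: sum.distrib sum_subtractf algebra_simps flip: sum_distrib_left)
  finally show ?thesis .
qed

lemma sum_powr_eq_chord:
  fixes f :: "'a \<Rightarrow> real" and p l u :: real
  assumes "l \<noteq> u" and ends: "\<And>v. v \<in> A \<Longrightarrow> f v \<in> {l, u}"
  defines "s \<equiv> (u powr p - l powr p) / (u - l)"
  shows "(\<Sum>v\<in>A. f v powr p) = real (card A) * l powr p + ((\<Sum>v\<in>A. f v) - real (card A) * l) * s"
proof -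
  have "s * (u - l) = u powr p - l powr p"
    using \<open>l \<noteq> u\<close> by (simp add: s_def)
  then have "f v powr p = s * (f v - l) + l powr p" if "v \<in> A" for v
    using ends[OF that] by auto
  then have "(\<Sum>v\<in>A. f v powr p) = (\<Sum>v\<in>A. s * (f v - l) + l powr p)"
    by (rule sum.cong[OF refl])
  also have "\<dots> = real (card A) * l powr p + ((\<Sum>v\<in>A. f v) - real (card A) * l) * s"
    by (simp add: sum.distrib sum_subtractf algebra_simps flip: sum_distrib_left)
  finally show ?thesis .
qed

section \<open>Neighbourhoods and degree sums\<close>

definition nbrs :: "('a, 'b) pre_digraph \<Rightarrow> 'a \<Rightarrow> 'a set" where
  "nbrs G v = {w. v \<rightarrow>\<^bsub>G\<^esub> w}"

context graph
begin

lemma nbrs_commute: "w \<in> nbrs G v \<longleftrightarrow> v \<in> nbrs G w"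
  using sym_arcs unfolding nbrs_def symmetric_def sym_def by blast

lemma not_in_own_nbrs: "v \<notin> nbrs G v"
  using no_loops by (auto simp: nbrs_def arcs_ends_conv)

lemma nbrs_subset_verts: "nbrs G v \<subseteq> verts G"
  by (auto simp: nbrs_def arcs_ends_conv)

lemma finite_nbrs: "finite (nbrs G v)"
  by (rule finite_subset[OF nbrs_subset_verts finite_verts])

lemma out_degree_eq_card_nbrs: "out_degree G v = card (nbrs G v)"
proof -
  have "bij_betw (head G) (out_arcs G v) (nbrs G v)"
    unfolding bij_betw_def
  proof
    show "inj_on (head G) (out_arcs G v)"
      by (rule inj_onI) (simp add: no_multi_arcs arc_to_ends_def)
    show "head G ` out_arcs G v = nbrs G v"
      by (force simp: nbrs_def arcs_ends_conv)
  qed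
  then show ?thesis
    unfolding out_degree_def by (rule bij_betw_same_card)
qed

lemma uedges_conv: "uedges G = {{v, w} | v w. w \<in> nbrs G v}"
  by (force simp: uedges_def nbrs_def arcs_ends_conv)

text \<open>
  Together with the injectivity below, this turns sums over the edges at a vertex into sums over
  its neighbours.
\<close>

lemma uedges_at: "{e \<in> uedges G. v \<in> e} = (\<lambda>w. {v, w}) ` nbrs G v"
proof
  show "{e \<in> uedges G. v \<in> e} \<subseteq> (\<lambda>w. {v, w}) ` nbrs G v"
  proof
    fix e assume "e \<in> {e \<in> uedges G. v \<in> e}"
    then obtain x y where "e = {x, y}" "y \<in> nbrs G x" "v = x \<or> v = y"
      by (auto simp: uedges_conv)
    then show "e \<in> (\<lambda>w. {v, w}) ` nbrs G v"
      using nbrs_commute[of x y] by auto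
  qed
  show "(\<lambda>w. {v, w}) ` nbrs G v \<subseteq> {e \<in> uedges G. v \<in> e}"
    by (auto simp: uedges_conv)
qed

lemma inj_on_uedge_at: "inj_on (\<lambda>w. {v, w}) (nbrs G v)"
  by (auto simp: inj_on_def doubleton_eq_iff)

lemma edge_nbhd_degree_eq_sum_nbrs:
  "edge_nbhd_degree G v =
     (\<Sum>w\<in>nbrs G v. real (out_degree G v) + real (out_degree G w) - 2)"
proof -
  have "edge_degree G {v, w} = real (out_degree G v) + real (out_degree G w) - 2"
    if "w \<in> nbrs G v" for w
  proof -
    have "v \<noteq> w"
      using that not_in_own_nbrs by blast
    then show ?thesis
      by (simp add: edge_degree_def)
  qed
  then show ?thesis
    by (simp add: edge_nbhd_degree_def uedges_at sum.reindex[OF inj_on_uedge_at] cong: sum.cong)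
qed

lemma out_degree_pos: "w \<in> nbrs G v \<Longrightarrow> 1 \<le> out_degree G v"
  using finite_nbrs[of v] by (auto simp: out_degree_eq_card_nbrs Suc_le_eq card_gt_0_iff)

lemma edge_nbhd_degree_nonneg: "0 \<le> edge_nbhd_degree G v"
  unfolding edge_nbhd_degree_eq_sum_nbrs
proof (rule sum_nonneg)
  fix w assume "w \<in> nbrs G v"
  then show "0 \<le> real (out_degree G v) + real (out_degree G w) - 2"
    using out_degree_pos[of w v] out_degree_pos[of v w] nbrs_commute[of w v] by simp
qed

text \<open>The handshake lemma, by double counting the pairs of an edge and one of its ends.\<close>

lemma sum_out_degree: "(\<Sum>v\<in>verts G. out_degree G v) = 2 * card (uedges G)"
proof -
  have fin: "finite (uedges G)"
    by (simp add: uedges_def)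
  have card_at: "out_degree G v = card {e \<in> uedges G. v \<in> e}" for v
    by (simp add: uedges_at out_degree_eq_card_nbrs card_image[OF inj_on_uedge_at])
  have "card {v \<in> verts G. v \<in> e} = 2" if e: "e \<in> uedges G" for e
  proof -
    obtain x y where xy: "e = {x, y}" "y \<in> nbrs G x"
      using e by (auto simp: uedges_conv)
    moreover have "x \<noteq> y"
      using xy not_in_own_nbrs[of x] by auto
    moreover have "{v \<in> verts G. v \<in> e} = e"
      using xy nbrs_subset_verts nbrs_commute[of y x] by blast
    ultimately show ?thesis
      by simp
  qed
  then show ?thesis
    by (simp add: card_at sum_multicount[OF finite_verts fin])
qed

text \<open>
  Adjacency is symmetric, so the term of \<open>w\<close> is counted once for each of the neighbours of \<open>w\<close>.
\<close>

lemma sum_nbrs_swap: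
  fixes f :: "'a \<Rightarrow> 'c::semiring_1"
  shows "(\<Sum>v\<in>verts G. \<Sum>w\<in>nbrs G v. f w) = (\<Sum>w\<in>verts G. of_nat (out_degree G w) * f w)"
proof -
  have nbrs_out: "{w \<in> verts G. w \<in> nbrs G v} = nbrs G v" for v
    using nbrs_subset_verts by blast
  have nbrs_in: "{v \<in> verts G. w \<in> nbrs G v} = nbrs G w" for w
    using nbrs_subset_verts nbrs_commute by blast
  have "(\<Sum>v\<in>verts G. \<Sum>w\<in>nbrs G v. f w) = (\<Sum>w\<in>verts G. \<Sum>v\<in>nbrs G w. f w)"
    using sum.swap_restrict[OF finite_verts finite_verts, of "\<lambda>_. f" "\<lambda>v w. w \<in> nbrs G v"]
    unfolding nbrs_out nbrs_in .
  then show ?thesis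
    by (simp add: out_degree_eq_card_nbrs)
qed

text \<open>
  An edge \<open>vw\<close> contributes \<open>d(v) + d(w) - 2\<close> at \<open>v\<close>. Summed over all \<open>v\<close> and \<open>w\<close>, the terms
  \<open>d(v)\<close> and \<open>d(w)\<close> both yield the sum of the squared degrees, which is kept in the form of the
  neighbour degree sums because these are bounded vertex by vertex below.
\<close>

lemma sum_edge_nbhd_degree:
  "(\<Sum>v\<in>verts G. edge_nbhd_degree G v) =
     2 * (\<Sum>v\<in>verts G. \<Sum>w\<in>nbrs G v. real (out_degree G w)) - 4 * real (card (uedges G))"
proof -
  have "edge_nbhd_degree G v =
      real (out_degree G v) * real (out_degree G v)
        + (\<Sum>w\<in>nbrs G v. real (out_degree G w)) - 2 * real (out_degree G v)" for v
    by (simp add: edge_nbhd_degree_eq_sum_nbrs sum.distrib sum_subtractf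
        flip: out_degree_eq_card_nbrs)
  moreover have "(\<Sum>v\<in>verts G. real (out_degree G v)) = 2 * real (card (uedges G))"
    using arg_cong[OF sum_out_degree, of real] by simp
  ultimately show ?thesis
    by (simp add: sum.distrib sum_subtractf sum_nbrs_swap flip: sum_distrib_left)
qed

section \<open>Second neighbourhoods without triangles and quadrangles\<close>

lemma triangle_imp_cycle:
  assumes "v \<in> nbrs G u" "w \<in> nbrs G v" "u \<in> nbrs G w"
  shows "\<exists>p. cycle p \<and> length p = 3"
proof -
  obtain e f g where "e \<in> arcs G" "f \<in> arcs G" "g \<in> arcs G"
    and "tail G e = u" "head G e = v" "tail G f = v" "head G f = w" "tail G g = w" "head G g = u"
    using assms by (auto simp: nbrs_def arcs_ends_conv)
  moreover have "u \<noteq> v" "v \<noteq> w" "w \<noteq> u"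
    using assms not_in_own_nbrs by blast+
  ultimately have "cycle [e, f, g]"
    unfolding cycle_def awalk_def by (intro exI[of _ u]) auto
  then show ?thesis
    by (intro exI[of _ "[e, f, g]"]) simp
qed

lemma quadrangle_imp_cycle:
  assumes "v \<in> nbrs G u" "w \<in> nbrs G v" "x \<in> nbrs G w" "u \<in> nbrs G x"
    and "u \<noteq> w" "v \<noteq> x"
  shows "\<exists>p. cycle p \<and> length p = 4"
proof -
  obtain e f g h where "e \<in> arcs G" "f \<in> arcs G" "g \<in> arcs G" "h \<in> arcs G"
    and "tail G e = u" "head G e = v" "tail G f = v" "head G f = w"
      "tail G g = w" "head G g = x" "tail G h = x" "head G h = u"
    using assms(1-4) by (auto simp: nbrs_def arcs_ends_conv)
  moreover have "u \<noteq> v" "v \<noteq> w" "w \<noteq> x" "x \<noteq> u"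
    using assms(1-4) not_in_own_nbrs by blast+
  ultimately have "cycle [e, f, g, h]"
    using assms(5,6) unfolding cycle_def awalk_def by (intro exI[of _ u]) auto
  then show ?thesis
    by (intro exI[of _ "[e, f, g, h]"]) simp
qed

text \<open>
  Each neighbour \<open>w\<close> of \<open>v\<close> is charged for itself and for its neighbours other than \<open>v\<close>, which
  makes \<open>d(w)\<close> vertices. A vertex charged to both \<open>w\<close> and \<open>w'\<close> would close a triangle
  \<open>v, w, w'\<close>, or a quadrangle through \<open>v\<close>, \<open>w\<close> and \<open>w'\<close>. So all these vertices are distinct,
  and none of them is \<open>v\<close>.
\<close>

lemma sum_degree_nbrs_le:
  assumes free: "triangle_quadrangle_free G" and v: "v \<in> verts G"
  shows "(\<Sum>w\<in>nbrs G v. out_degree G w) \<le> card (verts G) - 1"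
proof -
  define A where "A w = insert w (nbrs G w - {v})" for w
  have card_A: "card (A w) = out_degree G w" if "w \<in> nbrs G v" for w
  proof -
    have "v \<in> nbrs G w"
      using that nbrs_commute by blast
    then have "Suc (card (nbrs G w - {v})) = card (nbrs G w)"
      by (rule card_Suc_Diff1[OF finite_nbrs])
    then show ?thesis
      using finite_nbrs[of w] not_in_own_nbrs[of w] by (simp add: A_def out_degree_eq_card_nbrs)
  qed
  have disjoint: "A w \<inter> A w' = {}" if w: "w \<in> nbrs G v" "w' \<in> nbrs G v" "w \<noteq> w'" for w w'
  proof -
    have no_triangle: "w' \<notin> nbrs G w"
      using triangle_imp_cycle[of w v w'] w free nbrs_commute
      unfolding triangle_quadrangle_free_def by blast
    moreover have "x = v" if "x \<in> nbrs G w" "x \<in> nbrs G w'" for x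
      using quadrangle_imp_cycle[of w v x w'] that w free nbrs_commute
      unfolding triangle_quadrangle_free_def by blast
    ultimately show ?thesis
      using w(3) nbrs_commute[of w w'] by (auto simp: A_def)
  qed
  have "(\<Sum>w\<in>nbrs G v. out_degree G w) = card (\<Union>w\<in>nbrs G v. A w)"
    using disjoint card_A by (subst card_UN_disjoint) (auto simp: finite_nbrs A_def)
  also have "\<dots> \<le> card (verts G - {v})"
  proof (rule card_mono)
    show "(\<Union>w\<in>nbrs G v. A w) \<subseteq> verts G - {v}"
      using nbrs_subset_verts not_in_own_nbrs[of v] by (fastforce simp: A_def)
  qed simp
  also have "\<dots> = card (verts G) - 1"
    using v by simp
  finally show ?thesis .
qed

section \<open>Stars\<close>

lemma star_nbrs:
  assumes "complete_bipartite_digraph 1 k G"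
  obtains c V where "verts G = insert c V" "c \<notin> V" "card V = k"
    "nbrs G c = V" "\<And>v. v \<in> V \<Longrightarrow> nbrs G v = {c}"
proof -
  obtain U V where UV: "verts G = U \<union> V" "U \<inter> V = {}" "card U = 1" "card V = k"
    "arcs_ends G = U \<times> V \<union> V \<times> U"
    using assms unfolding complete_bipartite_digraph_def by blast
  then obtain c where "U = {c}"
    by (auto simp: card_1_singleton_iff)
  then show ?thesis
    using UV by (intro that[of c V]) (auto simp: nbrs_def)
qed

text \<open>
  The centre has \<open>k\<close> neighbours of degree \<open>1\<close>, a leaf has one neighbour of degree \<open>k\<close>.
\<close>

lemma star_sum_degree_nbrs:
  assumes "complete_bipartite_digraph 1 k G" "v \<in> verts G"
  shows "(\<Sum>w\<in>nbrs G v. out_degree G w) = k"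
proof -
  obtain c V where "verts G = insert c V" "c \<notin> V" "card V = k"
    "nbrs G c = V" "\<And>v. v \<in> V \<Longrightarrow> nbrs G v = {c}"
    using star_nbrs[OF assms(1)] by blast
  then show ?thesis
    using assms(2) by (auto simp: out_degree_eq_card_nbrs)
qed

text \<open>
  Each of the \<open>k\<close> edges has degree \<open>k - 1\<close>; all of them meet at the centre, and a leaf lies on
  one.
\<close>

lemma star_edge_nbhd_degree:
  assumes "complete_bipartite_digraph 1 k G" "v \<in> verts G"
  shows "edge_nbhd_degree G v \<in> {real k * (real k - 1), real k - 1}"
proof -
  obtain c V where star: "verts G = insert c V" "c \<notin> V" "card V = k"
    "nbrs G c = V" "\<And>v. v \<in> V \<Longrightarrow> nbrs G v = {c}"
    using star_nbrs[OF assms(1)] by blast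
  show ?thesis
    using assms(2) star by (auto simp: edge_nbhd_degree_eq_sum_nbrs out_degree_eq_card_nbrs)
qed

end

section \<open>The upper bound and its equality on stars\<close>

theorem corollary3p6:
  fixes G :: "('a, 'b) pre_digraph"
    and n m :: nat
    and a \<delta> \<Delta> s :: real
  assumes "graph G"
    and "Digraph_Component.connected G"
    and "triangle_quadrangle_free G"
    and "n = card (verts G)"
    and "n \<ge> 3"
    and "m = card (uedges G)"
    and "\<delta> = Min (edge_nbhd_degree G ` verts G)"
    and "\<Delta> = Max (edge_nbhd_degree G ` verts G)"
    and "\<delta> \<noteq> \<Delta>"
    and "a > 1"
    and "s = (\<Delta> powr a - \<delta> powr a) / (\<Delta> - \<delta>)"
  shows "kulli_basava a G
           \<le> real n * \<delta> powr a + (2 * real n * (real n - 1) - 4 * real m - real n * \<delta>) * s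
    \<and> (complete_bipartite_digraph 1 (n - 1) G \<longrightarrow>
         kulli_basava a G
           = real n * \<delta> powr a + (2 * real n * (real n - 1) - 4 * real m - real n * \<delta>) * s)"
proof -
  interpret graph G by fact
  let ?S = "edge_nbhd_degree G"
  have range: "finite (?S ` verts G)" "?S ` verts G \<noteq> {}"
    using assms(4,5) by auto
  have bounds: "?S v \<in> {\<delta>..\<Delta>}" if "v \<in> verts G" for v
    using that range by (simp add: assms(7,8))
  have attained: "\<delta> \<in> ?S ` verts G" "\<Delta> \<in> ?S ` verts G"
    using range unfolding assms(7,8) by (auto intro: Min_in Max_in)
  have \<delta>_nonneg: "0 \<le> \<delta>"
    using attained(1) edge_nbhd_degree_nonneg by auto
  have "\<delta> < \<Delta>"
    using attained(1) bounds \<open>\<delta> \<noteq> \<Delta>\<close> by force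
  then have s_nonneg: "0 \<le> s"
    using \<delta>_nonneg \<open>a > 1\<close> unfolding assms(11)
    by (intro divide_nonneg_pos) (auto intro: powr_mono2)

  have total: "(\<Sum>v\<in>verts G. ?S v) =
      2 * (\<Sum>v\<in>verts G. \<Sum>w\<in>nbrs G v. real (out_degree G w)) - 4 * real m"
    by (simp add: sum_edge_nbhd_degree assms(6))
  have n1: "real (n - 1) = real n - 1"
    using \<open>n \<ge> 3\<close> by simp

  have "(\<Sum>w\<in>nbrs G v. real (out_degree G w)) \<le> real n - 1" if "v \<in> verts G" for v
    using sum_degree_nbrs_le[OF \<open>triangle_quadrangle_free G\<close> that] n1 assms(4)
    by (metis of_nat_le_iff of_nat_sum)
  then have "(\<Sum>v\<in>verts G. \<Sum>w\<in>nbrs G v. real (out_degree G w)) \<le> real n * (real n - 1)"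
    unfolding assms(4) by (rule sum_bounded_above)
  then have "(\<Sum>v\<in>verts G. ?S v) - real n * \<delta> \<le> 2 * real n * (real n - 1) - 4 * real m - real n * \<delta>"
    by (simp add: total)
  then have "real n * \<delta> powr a + ((\<Sum>v\<in>verts G. ?S v) - real n * \<delta>) * s
      \<le> real n * \<delta> powr a + (2 * real n * (real n - 1) - 4 * real m - real n * \<delta>) * s"
    using s_nonneg by (intro add_left_mono mult_right_mono)
  moreover have "kulli_basava a G \<le> real n * \<delta> powr a + ((\<Sum>v\<in>verts G. ?S v) - real n * \<delta>) * s"
    unfolding kulli_basava_def assms(4,11)
    using \<open>a > 1\<close> \<delta>_nonneg bounds by (intro sum_powr_le_chord) auto
  moreover have "kulli_basava a G
      = real n * \<delta> powr a + (2 * real n * (real n - 1) - 4 * real m - real n * \<delta>) * s"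
    if star: "complete_bipartite_digraph 1 (n - 1) G"
  proof -
    have "(\<Sum>w\<in>nbrs G v. real (out_degree G w)) = real n - 1" if "v \<in> verts G" for v
      using star_sum_degree_nbrs[OF star that] n1 by (metis of_nat_sum)
    then have sum_S: "(\<Sum>v\<in>verts G. ?S v) = 2 * real n * (real n - 1) - 4 * real m"
      by (simp add: total assms(4))
    obtain x y where xy: "x \<in> verts G" "y \<in> verts G" "\<delta> = ?S x" "\<Delta> = ?S y"
      using attained by blast
    \<comment> \<open>Two distinct attained values exhaust the two values possible on a star.\<close>
    have "?S v \<in> {\<delta>, \<Delta>}" if "v \<in> verts G" for v
      using star_edge_nbhd_degree[OF star xy(1)] star_edge_nbhd_degree[OF star xy(2)]
        star_edge_nbhd_degree[OF star that] xy(3,4) \<open>\<delta> \<noteq> \<Delta>\<close> by auto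
    then have "kulli_basava a G = real n * \<delta> powr a + ((\<Sum>v\<in>verts G. ?S v) - real n * \<delta>) * s"
      unfolding kulli_basava_def assms(4,11) using \<open>\<delta> \<noteq> \<Delta>\<close> by (intro sum_powr_eq_chord)
    then show ?thesis
      by (simp add: sum_S)
  qed
  ultimately show ?thesis
    by linarith
qed

end
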